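(* Let $U=U_1\times\cdots\times U_m$ be a Cartesian product of nonempty finite sets and let $S\subseteq U$. The Natarajan dimension of $S$ equals the $\mathcal M_N(U)$-density of $S$; (when $U_1=\cdots=U_m$) for every class $\Psi$ the $\Psi$-dimension of $S$ equals the $\mathcal M_\Psi(U)$-density of $S$; and the DS-dimension of $S$ does not exceed the $\mathrm{M^{\circ}_{bin}Prod}^{**}(U)$-density of $S$. Each of these dimensions does not exceed the VC-density of $S$.
   Context: Let $X=\{1,\dots,m\}$; maxima over empty sets are taken to be $0$. For $A\subseteq X$, $s|_A$ is the restriction of a tuple $s$ to coordinates in $A$, and $S_A=\{s|_A:s\in S\}$. A subproduct of $U$ with support $A$ is $V=\prod_{i\in A}V_i$ with $\varnothing\ne V_i\subseteq U_i$. A minor-subproduct $M(\Lambda,V)$ of $V$ is given by $\Lambda=(\alpha_i)_{i\in A}$, $\alpha_i$ a partition of $V_i$ into nonempty blocks, and is the product $\prod_{i\in A}M_i$, with $M_i$ the set of blocks of $\alpha_i$; its dimension is $\sum_{i\in A}(|M_i|-1)$. $M(\Lambda,V)$ is shattered by $S\subseteq U$ if for every choice of blocks $P^i\in\alpha_i$ ($i\in A$) there is $s\in S$ with $s_i\in P^i$ for all $i\in A$. $\mathrm{MProd}^{**}(U)$ is the set of all minor-subproducts of all subproducts of $U$. For $\mathcal M\subseteq\mathrm{MProd}^{**}(U)$, the $\mathcal M$-density of $S$ is the largest dimension of an $M\in\mathcal M$ shattered by $S$. The VC-density of $S$ is its $\mathrm{MProd}^{**}(U)$-density. Natarajan dimension: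 a cube of dimension $d$ is a subproduct $C=C_{i_1}\times\cdots\times C_{i_d}$ with all $|C_{i_j}|=2$. $Y\subseteq X$ is Natarajan-shattered by $S$ if $S_Y$ contains a cube of dimension $|Y|$; the Natarajan dimension is the maximum size of a Natarajan-shattered $Y$. $\mathcal M_N(U)$ is the set of the minor-subproducts $M_C$, over all cubes $C$, where $M_C=M(\Lambda,C)$ with each $\alpha_{i_j}$ the partition of $C_{i_j}$ into two singletons. $\Psi$-dimension: assume $U_1=\cdots=U_m$ and let $\Psi$ be a class of functions $\overline\psi:U\to\{0,1,*\}^m$ of the form $\overline\psi(u)=(\psi_1(u_1),\dots,\psi_m(u_m))$ with $\psi_i:U_i\to\{0,1,*\}$. $Y\subseteq X$ is $\Psi$-shattered by $S$ if there is $\overline\psi\in\Psi$ with $\{0,1\}^{Y}\subseteq\{\overline\psi(s)|_Y:s\in S\}$. The $\Psi$-dimension of $S$ is the largest $|Y|$ of a $\Psi$-shattered $Y$. $\mathcal M_\Psi(U)$ is the set of all $M(\Lambda,V)$ obtained from some $\overline\psi\in\Psi$ and $Y\subseteq X$ (such that $\psi_i^{-1}(0),\psi_i^{-1}(1)$ are nonempty for $i\in Y$) by $V=\prod_{i\in Y}\psi_i^{-1}(\{0,1\})$ and $\alpha_i=\{\psi_i^{-1}(0),\psi_i^{-1}(1)\}$, $i\in Y$. DS-dimension: a nonempty set $C\subseteq U_{i_1}\times\cdots\times U_{i_k}$ is a pseudo-cube if for every $u\in C$ and every coordinate $i_j$ there is $v\in C$ that differs from $u$ exactly in coordinate $i_j$.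 $Y\subseteq X$ is DS-shattered by $S$ if $S_Y$ contains a pseudo-cube (in $\prod_{i\in Y}U_i$); the DS-dimension is the maximum size of a DS-shattered $Y$. $\mathrm{M^{\circ}_{bin}Prod}^{**}(U)$ is the set of all minor-subproducts $M(a)=M(\Lambda,V)$ over all subproducts of the form $V=\prod_{i\in A}U_i$, $A\subseteq X$, and all $a\in V$, where $\alpha_i=\{\{a_i\},U_i\setminus\{a_i\}\}$ (with the empty block omitted if $|U_i|=1$). *)

theory Defs
  imports Main "HOL-Library.FuncSet" "HOL-Library.Disjoint_Sets"
begin

text \<open>
  The coordinate set is \<open>{1..m}\<close>. A tuple indexed by \<open>A\<close> is an extensional function, so
  \<open>U = U\<^sub>1 \<times> \<dots> \<times> U\<^sub>m\<close> is \<open>\<Pi>\<^sub>E i\<in>{1..m}. U i\<close>. All factors are sets over one common type.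

  Every ``largest'' or ``maximum'' below is the supremum on \<^typ>\<open>nat\<close>: by definition it is \<open>0\<close>
  on the empty set and \<open>Max\<close> otherwise.
\<close>

definition restr_set :: "nat set \<Rightarrow> (nat \<Rightarrow> 'a) set \<Rightarrow> (nat \<Rightarrow> 'a) set" where
  "restr_set A S = (\<lambda>s. restrict s A) ` S"

text \<open>
  A subproduct is given by its support and its family of factors, and \<open>M(\<Lambda>,V)\<close> additionally by
  the family \<open>\<Lambda>\<close> of partitions. The support is part of the data because it cannot in general be
  read off from a set of extensional functions.
\<close>

definition subproduct :: "nat \<Rightarrow> (nat \<Rightarrow> 'a set) \<Rightarrow> nat set \<Rightarrow> (nat \<Rightarrow> 'a set) \<Rightarrow> bool" where
  "subproduct m U A V \<longleftrightarrow> A \<subseteq> {1..m} \<and> V \<in> (\<Pi>\<^sub>E i\<in>A. {W. W \<noteq> {} \<and> W \<subseteq> U i})"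

record 'a minor =
  supp :: "nat set"
  factors :: "nat \<Rightarrow> 'a set"
  parts :: "nat \<Rightarrow> 'a set set"

definition minor_points :: "'a minor \<Rightarrow> (nat \<Rightarrow> 'a set) set" where
  "minor_points M = (\<Pi>\<^sub>E i\<in>supp M. parts M i)"

definition minor_dim :: "'a minor \<Rightarrow> nat" where
  "minor_dim M = (\<Sum>i\<in>supp M. card (parts M i) - 1)"

definition shattered :: "(nat \<Rightarrow> 'a) set \<Rightarrow> 'a minor \<Rightarrow> bool" where
  "shattered S M \<longleftrightarrow> (\<forall>P\<in>minor_points M. \<exists>s\<in>S. \<forall>i\<in>supp M. s i \<in> P i)"

definition MProd :: "nat \<Rightarrow> (nat \<Rightarrow> 'a set) \<Rightarrow> 'a minor set" where
  "MProd m U = {M. subproduct m U (supp M) (factors M) \<and>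
     parts M \<in> (\<Pi>\<^sub>E i\<in>supp M. {\<alpha>. partition_on (factors M i) \<alpha>})}"

definition minor_density :: "'a minor set \<Rightarrow> (nat \<Rightarrow> 'a) set \<Rightarrow> nat" where
  "minor_density \<M> S = Sup {minor_dim M | M. M \<in> \<M> \<and> shattered S M}"

definition vc_density :: "nat \<Rightarrow> (nat \<Rightarrow> 'a set) \<Rightarrow> (nat \<Rightarrow> 'a) set \<Rightarrow> nat" where
  "vc_density m U S = minor_density (MProd m U) S"


subsection \<open>Natarajan dimension\<close>

definition cube :: "nat \<Rightarrow> (nat \<Rightarrow> 'a set) \<Rightarrow> nat set \<Rightarrow> (nat \<Rightarrow> 'a set) \<Rightarrow> bool" where
  "cube m U A C \<longleftrightarrow> subproduct m U A C \<and> (\<forall>i\<in>A. card (C i) = 2)"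

text \<open>A cube of dimension \<open>card Y\<close> inside \<open>S\<^sub>Y\<close> consists of \<open>Y\<close>-tuples, so its support is \<open>Y\<close>.\<close>

definition natarajan_shattered ::
    "nat \<Rightarrow> (nat \<Rightarrow> 'a set) \<Rightarrow> (nat \<Rightarrow> 'a) set \<Rightarrow> nat set \<Rightarrow> bool" where
  "natarajan_shattered m U S Y \<longleftrightarrow> (\<exists>C. cube m U Y C \<and> (\<Pi>\<^sub>E i\<in>Y. C i) \<subseteq> restr_set Y S)"

definition natarajan_dim :: "nat \<Rightarrow> (nat \<Rightarrow> 'a set) \<Rightarrow> (nat \<Rightarrow> 'a) set \<Rightarrow> nat" where
  "natarajan_dim m U S = Sup {card Y | Y. Y \<subseteq> {1..m} \<and> natarajan_shattered m U S Y}"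

definition M_N :: "nat \<Rightarrow> (nat \<Rightarrow> 'a set) \<Rightarrow> 'a minor set" where
  "M_N m U = {\<lparr>supp = A, factors = C, parts = (\<lambda>i\<in>A. (\<lambda>x. {x}) ` C i)\<rparr> | A C. cube m U A C}"


subsection \<open>\<open>\<Psi>\<close>-dimension\<close>

datatype label = L0 | L1 | Star

definition psi_bar ::
    "nat \<Rightarrow> (nat \<Rightarrow> 'a set) \<Rightarrow> (nat \<Rightarrow> 'a \<Rightarrow> label) \<Rightarrow> (nat \<Rightarrow> 'a) \<Rightarrow> nat \<Rightarrow> label" where
  "psi_bar m U \<psi> = (\<lambda>u\<in>(\<Pi>\<^sub>E i\<in>{1..m}. U i). \<lambda>i\<in>{1..m}. \<psi> i (u i))"

definition psi_class ::
    "nat \<Rightarrow> (nat \<Rightarrow> 'a set) \<Rightarrow> ((nat \<Rightarrow> 'a) \<Rightarrow> nat \<Rightarrow> label) set \<Rightarrow> bool" where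
  "psi_class m U \<Psi> \<longleftrightarrow> \<Psi> \<subseteq> range (psi_bar m U)"

definition psi_shattered ::
    "((nat \<Rightarrow> 'a) \<Rightarrow> nat \<Rightarrow> label) set \<Rightarrow> (nat \<Rightarrow> 'a) set \<Rightarrow> nat set \<Rightarrow> bool" where
  "psi_shattered \<Psi> S Y \<longleftrightarrow> (\<exists>\<chi>\<in>\<Psi>. (\<Pi>\<^sub>E i\<in>Y. {L0, L1}) \<subseteq> restr_set Y (\<chi> ` S))"

definition psi_dim ::
    "nat \<Rightarrow> ((nat \<Rightarrow> 'a) \<Rightarrow> nat \<Rightarrow> label) set \<Rightarrow> (nat \<Rightarrow> 'a) set \<Rightarrow> nat" where
  "psi_dim m \<Psi> S = Sup {card Y | Y. Y \<subseteq> {1..m} \<and> psi_shattered \<Psi> S Y}"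

text \<open>
  When all \<open>U i\<close> are nonempty, \<open>psi_bar m U \<psi>\<close> determines each \<open>\<psi> i\<close> on \<open>U i\<close>, which is all that
  is used of \<open>\<psi>\<close> here.
\<close>

definition psi_fibre :: "(nat \<Rightarrow> 'a set) \<Rightarrow> (nat \<Rightarrow> 'a \<Rightarrow> label) \<Rightarrow> label set \<Rightarrow> nat \<Rightarrow> 'a set" where
  "psi_fibre U \<psi> L i = {x \<in> U i. \<psi> i x \<in> L}"

definition M_Psi ::
    "nat \<Rightarrow> (nat \<Rightarrow> 'a set) \<Rightarrow> ((nat \<Rightarrow> 'a) \<Rightarrow> nat \<Rightarrow> label) set \<Rightarrow> 'a minor set" where
  "M_Psi m U \<Psi> =
    {\<lparr>supp = Y, factors = (\<lambda>i\<in>Y. psi_fibre U \<psi> {L0, L1} i),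
       parts = (\<lambda>i\<in>Y. {psi_fibre U \<psi> {L0} i, psi_fibre U \<psi> {L1} i})\<rparr>
     | \<psi> Y. psi_bar m U \<psi> \<in> \<Psi> \<and> Y \<subseteq> {1..m} \<and>
         (\<forall>i\<in>Y. psi_fibre U \<psi> {L0} i \<noteq> {} \<and> psi_fibre U \<psi> {L1} i \<noteq> {})}"


subsection \<open>DS-dimension\<close>

definition pseudo_cube :: "(nat \<Rightarrow> 'a set) \<Rightarrow> nat set \<Rightarrow> (nat \<Rightarrow> 'a) set \<Rightarrow> bool" where
  "pseudo_cube U Y C \<longleftrightarrow> C \<noteq> {} \<and> C \<subseteq> (\<Pi>\<^sub>E i\<in>Y. U i) \<and>
     (\<forall>u\<in>C. \<forall>i\<in>Y. \<exists>v\<in>C. {j\<in>Y. u j \<noteq> v j} = {i})"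

definition ds_shattered :: "(nat \<Rightarrow> 'a set) \<Rightarrow> (nat \<Rightarrow> 'a) set \<Rightarrow> nat set \<Rightarrow> bool" where
  "ds_shattered U S Y \<longleftrightarrow> (\<exists>C. pseudo_cube U Y C \<and> C \<subseteq> restr_set Y S)"

definition ds_dim :: "nat \<Rightarrow> (nat \<Rightarrow> 'a set) \<Rightarrow> (nat \<Rightarrow> 'a) set \<Rightarrow> nat" where
  "ds_dim m U S = Sup {card Y | Y. Y \<subseteq> {1..m} \<and> ds_shattered U S Y}"

definition M_bin :: "nat \<Rightarrow> (nat \<Rightarrow> 'a set) \<Rightarrow> 'a minor set" where
  "M_bin m U =
    {\<lparr>supp = A, factors = (\<lambda>i\<in>A. U i), parts = (\<lambda>i\<in>A. {{a i}, U i - {a i}} - {{}})\<rparr>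
     | A a. A \<subseteq> {1..m} \<and> a \<in> (\<Pi>\<^sub>E i\<in>A. U i)}"

end

theory Submission imports Defs begin

text \<open>
  Natarajan- and \<open>\<Psi>\<close>-shattering of \<open>Y\<close> is literally shattering of the associated
  minor-subproduct of dimension \<open>card Y\<close>. If \<open>C\<close> is a pseudo-cube and \<open>a \<in> C\<close>, then starting
  from \<open>a\<close> the coordinates of any \<open>D \<subseteq> Y\<close> can be changed one at a time inside \<open>C\<close>; the points
  of \<open>C\<close> so reached shatter \<open>M(a)\<close>.
\<close>

section \<open>Suprema of natural numbers, restricted tuples and finiteness of densities\<close>

text \<open>Finiteness of \<open>B\<close> makes its supremum a genuine maximum; an empty
  \<open>A\<close> is harmless because its supremum is \<open>0\<close>.\<close>

lemma Sup_nat_mono: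
  fixes A B :: "nat set"
  assumes "A \<subseteq> B" "finite B"
  shows "Sup A \<le> Sup B"
  using assms by (auto simp: Sup_nat_def intro: Max_mono)

lemma mem_restr_set_iff:
  assumes "f \<in> extensional A"
  shows "f \<in> restr_set A S \<longleftrightarrow> (\<exists>s\<in>S. \<forall>i\<in>A. s i = f i)"
proof -
  have "f = restrict s A \<longleftrightarrow> (\<forall>i\<in>A. s i = f i)" for s
    using assms by (force simp: fun_eq_iff extensional_def)
  then show ?thesis by (auto simp: restr_set_def)
qed

text \<open>Every two-block coordinate contributes \<open>2 - 1 = 1\<close>. All minor-subproducts
  built from shattered sets below are of this binary kind.\<close>

lemma minor_dim_binary:
  assumes "\<And>i. i \<in> supp M \<Longrightarrow> card (parts M i) = 2"
  shows "minor_dim M = card (supp M)"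
  using assms by (simp add: minor_dim_def)

text \<open>The blocks at coordinate \<open>i\<close> are subsets of \<open>U i\<close>, so each
  summand of the dimension is at most \<open>card (Pow (U i))\<close>. This crude bound ensures that
  the supremum defining a density is a maximum.\<close>

lemma finite_minor_dims:
  assumes fin: "\<And>i. i \<in> {1..m} \<Longrightarrow> finite (U i)" and "\<M> \<subseteq> MProd m U"
  shows "finite {minor_dim M | M. M \<in> \<M> \<and> shattered S M}"
proof (rule finite_subset)
  show "{minor_dim M | M. M \<in> \<M> \<and> shattered S M} \<subseteq> {..\<Sum>i\<in>{1..m}. card (Pow (U i))}"
  proof safe
    fix M assume "M \<in> \<M>"
    then have M: "M \<in> MProd m U" using assms by blast
    then have sub: "supp M \<subseteq> {1..m}" by (auto simp: MProd_def subproduct_def)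
    have "card (parts M i) - 1 \<le> card (Pow (U i))" if i: "i \<in> supp M" for i
    proof -
      have "factors M i \<subseteq> U i" "partition_on (factors M i) (parts M i)"
        using M i by (auto simp: MProd_def subproduct_def PiE_iff)
      then have "parts M i \<subseteq> Pow (U i)" by (auto simp: partition_on_def)
      then have "card (parts M i) \<le> card (Pow (U i))"
        using fin i sub by (intro card_mono) auto
      then show ?thesis by simp
    qed
    then have "minor_dim M \<le> (\<Sum>i\<in>supp M. card (Pow (U i)))"
      unfolding minor_dim_def by (rule sum_mono)
    also have "\<dots> \<le> (\<Sum>i\<in>{1..m}. card (Pow (U i)))"
      using sub by (intro sum_mono2) auto
    finally show "minor_dim M \<le> (\<Sum>i\<in>{1..m}. card (Pow (U i)))" .
  qed
qed simp

text \<open>A smaller family offers fewer shattered candidates, and the dimensions coming from all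
  of \<open>MProd m U\<close> form a finite set.\<close>

lemma minor_density_le_vc_density:
  assumes "\<And>i. i \<in> {1..m} \<Longrightarrow> finite (U i)" "\<M> \<subseteq> MProd m U"
  shows "minor_density \<M> S \<le> vc_density m U S"
  unfolding vc_density_def minor_density_def
  using assms(2) finite_minor_dims[OF assms(1) order.refl] by (intro Sup_nat_mono) auto


subsection \<open>Natarajan dimension\<close>

lemma M_N_subset_MProd: "M_N m U \<subseteq> MProd m U"
  by (auto simp: M_N_def MProd_def cube_def partition_on_def disjoint_def)

text \<open>Choosing one singleton block per coordinate amounts to choosing a point of the cube, and
  a tuple meeting these blocks is one that restricts to that point.\<close>

lemma shattered_singletons_iff:
  "shattered S \<lparr>supp = A, factors = C, parts = (\<lambda>i\<in>A. (\<lambda>x. {x}) ` C i)\<rparr> \<longleftrightarrow>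
     (\<Pi>\<^sub>E i\<in>A. C i) \<subseteq> restr_set A S" (is "shattered S ?M \<longleftrightarrow> ?R")
proof
  assume sh: "shattered S ?M"
  show ?R
  proof
    fix f assume f: "f \<in> (\<Pi>\<^sub>E i\<in>A. C i)"
    then have "(\<lambda>i\<in>A. {f i}) \<in> minor_points ?M"
      by (auto simp: minor_points_def PiE_iff)
    then obtain s where "s \<in> S" "\<forall>i\<in>A. s i = f i"
      using sh by (force simp: shattered_def)
    then show "f \<in> restr_set A S"
      using f by (auto simp: mem_restr_set_iff PiE_def)
  qed
next
  assume R: ?R
  show "shattered S ?M"
    unfolding shattered_def
  proof
    fix P assume P: "P \<in> minor_points ?M"
    then have "\<forall>i\<in>A. \<exists>x\<in>C i. P i = {x}"
      by (auto simp: minor_points_def PiE_iff)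
    then obtain g where g: "\<And>i. i \<in> A \<Longrightarrow> g i \<in> C i \<and> P i = {g i}" by metis
    then have "restrict g A \<in> restr_set A S" using R by auto
    then show "\<exists>s\<in>S. \<forall>i\<in>supp ?M. s i \<in> P i"
      using g by (auto simp: mem_restr_set_iff)
  qed
qed

lemma natarajan_dim_eq_density: "natarajan_dim m U S = minor_density (M_N m U) S"
proof -
  have dim: "minor_dim \<lparr>supp = A, factors = C, parts = (\<lambda>i\<in>A. (\<lambda>x. {x}) ` C i)\<rparr> = card A"
    if "cube m U A C" for A C
    using that by (subst minor_dim_binary) (auto simp: cube_def card_image)
  \<comment> \<open>The condition \<open>Y \<subseteq> {1..m}\<close> is absorbed by
    \<open>cube\<close>, and the witness \<open>C\<close> moves to the outer existential to match
    the indexing of \<open>M_N\<close>.\<close>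
  have "{card Y | Y. Y \<subseteq> {1..m} \<and> natarajan_shattered m U S Y} =
      {card Y | Y C. cube m U Y C \<and> (\<Pi>\<^sub>E i\<in>Y. C i) \<subseteq> restr_set Y S}"
    by (force simp: natarajan_shattered_def cube_def subproduct_def)
  also have "\<dots> = {minor_dim M | M. M \<in> M_N m U \<and> shattered S M}"
  proof -
    have "{minor_dim M | M. M \<in> M_N m U \<and> shattered S M} =
        {minor_dim \<lparr>supp = A, factors = C, parts = (\<lambda>i\<in>A. (\<lambda>x. {x}) ` C i)\<rparr> | A C.
          cube m U A C \<and> (\<Pi>\<^sub>E i\<in>A. C i) \<subseteq> restr_set A S}"
      unfolding M_N_def shattered_singletons_iff[symmetric] by blast
    also have "\<dots> = {card A | A C. cube m U A C \<and> (\<Pi>\<^sub>E i\<in>A. C i) \<subseteq> restr_set A S}"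
      by (intro Collect_cong ex_cong1) (auto simp: dim)
    finally show ?thesis by simp
  qed
  finally show ?thesis by (simp add: natarajan_dim_def minor_density_def)
qed


subsection \<open>\<open>\<Psi>\<close>-dimension\<close>

lemma psi_fibre_disjoint: "psi_fibre U \<psi> {L0} i \<inter> psi_fibre U \<psi> {L1} i = {}"
  by (auto simp: psi_fibre_def)

text \<open>The fibre over both labels is the disjoint union of the two single-label fibres, which
  \<open>M_Psi\<close> requires to be nonempty.\<close>

lemma M_Psi_subset_MProd: "M_Psi m U \<Psi> \<subseteq> MProd m U"
proof -
  have "psi_fibre U \<psi> {L0, L1} i = psi_fibre U \<psi> {L0} i \<union> psi_fibre U \<psi> {L1} i" for \<psi> i
    by (auto simp: psi_fibre_def)
  moreover have "psi_fibre U \<psi> L i \<subseteq> U i" for \<psi> L i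
    by (auto simp: psi_fibre_def)
  ultimately show ?thesis
    using psi_fibre_disjoint[of U]
    by (auto simp: M_Psi_def MProd_def subproduct_def partition_on_def disjoint_def) blast+
qed

text \<open>For tuples in \<open>U\<close> and coordinates in \<open>{1..m}\<close>, where
  \<open>psi_bar\<close> takes its intended values, carrying label \<open>f i\<close> at
  \<open>i\<close> means lying in the corresponding fibre.\<close>

lemma psi_shattered_by_iff:
  assumes S: "S \<subseteq> (\<Pi>\<^sub>E i\<in>{1..m}. U i)" and Y: "Y \<subseteq> {1..m}"
  shows "(\<Pi>\<^sub>E i\<in>Y. {L0, L1}) \<subseteq> restr_set Y (psi_bar m U \<psi> ` S) \<longleftrightarrow>
    (\<forall>f\<in>\<Pi>\<^sub>E i\<in>Y. {L0, L1}. \<exists>s\<in>S. \<forall>i\<in>Y. s i \<in> psi_fibre U \<psi> {f i} i)"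
proof -
  have "psi_bar m U \<psi> s i = f i \<longleftrightarrow> s i \<in> psi_fibre U \<psi> {f i} i"
    if "s \<in> S" "i \<in> Y" for s i and f :: "nat \<Rightarrow> label"
  proof -
    have "s \<in> (\<Pi>\<^sub>E i\<in>{1..m}. U i)" "i \<in> {1..m}" using that S Y by blast+
    then show ?thesis by (auto simp: psi_bar_def psi_fibre_def)
  qed
  then have "f \<in> restr_set Y (psi_bar m U \<psi> ` S) \<longleftrightarrow>
      (\<exists>s\<in>S. \<forall>i\<in>Y. s i \<in> psi_fibre U \<psi> {f i} i)" if "f \<in> (\<Pi>\<^sub>E i\<in>Y. {L0, L1})" for f
    using that by (subst mem_restr_set_iff) (auto simp: PiE_def)
  then show ?thesis by blast
qed

text \<open>Block choices correspond to 0-1 labellings \<open>f\<close> of \<open>Y\<close>: the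
  label \<open>f i\<close> selects the fibre at \<open>i\<close>. With
  \<open>psi_shattered_by_iff\<close> this identifies the two notions of shattering.\<close>

lemma shattered_fibres_iff:
  "shattered S \<lparr>supp = Y, factors = F,
       parts = (\<lambda>i\<in>Y. {psi_fibre U \<psi> {L0} i, psi_fibre U \<psi> {L1} i})\<rparr> \<longleftrightarrow>
    (\<forall>f\<in>\<Pi>\<^sub>E i\<in>Y. {L0, L1}. \<exists>s\<in>S. \<forall>i\<in>Y. s i \<in> psi_fibre U \<psi> {f i} i)"
  (is "shattered S ?M \<longleftrightarrow> ?R")
proof
  assume sh: "shattered S ?M"
  show ?R
  proof
    fix f assume f: "f \<in> (\<Pi>\<^sub>E i\<in>Y. {L0, L1})"
    then have "f i = L0 \<or> f i = L1" if "i \<in> Y" for i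
      using that by auto
    then have "(\<lambda>i\<in>Y. psi_fibre U \<psi> {f i} i) \<in> minor_points ?M"
      by (force simp: minor_points_def)
    then show "\<exists>s\<in>S. \<forall>i\<in>Y. s i \<in> psi_fibre U \<psi> {f i} i"
      using sh by (force simp: shattered_def)
  qed
next
  assume R: ?R
  show "shattered S ?M"
    unfolding shattered_def
  proof
    fix P assume P: "P \<in> minor_points ?M"
    then have "\<forall>i\<in>Y. \<exists>l\<in>{L0, L1}. P i = psi_fibre U \<psi> {l} i"
      by (auto simp: minor_points_def PiE_iff)
    then obtain g where g: "\<And>i. i \<in> Y \<Longrightarrow> g i \<in> {L0, L1} \<and> P i = psi_fibre U \<psi> {g i} i"
      by metis
    then have "restrict g Y \<in> (\<Pi>\<^sub>E i\<in>Y. {L0, L1})" by auto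
    then obtain s where "s \<in> S" "\<forall>i\<in>Y. s i \<in> psi_fibre U \<psi> {restrict g Y i} i"
      using R by blast
    then show "\<exists>s\<in>S. \<forall>i\<in>supp ?M. s i \<in> P i"
      using g by auto
  qed
qed

text \<open>A tuple realising the constant labelling \<open>l\<close> puts a point in every
  \<open>l\<close>-fibre. This recovers the nonemptiness that \<open>M_Psi\<close> demands but
  \<open>psi_shattered\<close> does not mention.\<close>

lemma fibres_nonempty:
  assumes "\<forall>f\<in>\<Pi>\<^sub>E i\<in>Y. {L0, L1}. \<exists>s\<in>S. \<forall>i\<in>Y. s i \<in> psi_fibre U \<psi> {f i} i" "i \<in> Y"
  shows "psi_fibre U \<psi> {L0} i \<noteq> {}" "psi_fibre U \<psi> {L1} i \<noteq> {}"
proof -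
  have "psi_fibre U \<psi> {l} i \<noteq> {}" if "l \<in> {L0, L1}" for l
  proof -
    have "(\<lambda>i\<in>Y. l) \<in> (\<Pi>\<^sub>E i\<in>Y. {L0, L1})" using that by auto
    then obtain s where "\<forall>j\<in>Y. s j \<in> psi_fibre U \<psi> {(\<lambda>i\<in>Y. l) j} j"
      using assms(1) by blast
    then show ?thesis using \<open>i \<in> Y\<close> by auto
  qed
  then show "psi_fibre U \<psi> {L0} i \<noteq> {}" "psi_fibre U \<psi> {L1} i \<noteq> {}" by auto
qed

lemma psi_dim_eq_density:
  assumes S: "S \<subseteq> (\<Pi>\<^sub>E i\<in>{1..m}. U i)" and \<Psi>: "psi_class m U \<Psi>"
  shows "psi_dim m \<Psi> S = minor_density (M_Psi m U \<Psi>) S"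
proof -
  define M where "M \<psi> Y = \<lparr>supp = Y, factors = (\<lambda>i\<in>Y. psi_fibre U \<psi> {L0, L1} i),
       parts = (\<lambda>i\<in>Y. {psi_fibre U \<psi> {L0} i, psi_fibre U \<psi> {L1} i})\<rparr>" for \<psi> Y
  define ne where "ne \<psi> Y \<longleftrightarrow> (\<forall>i\<in>Y. psi_fibre U \<psi> {L0} i \<noteq> {} \<and> psi_fibre U \<psi> {L1} i \<noteq> {})"
    for \<psi> Y
  have dim: "minor_dim (M \<psi> Y) = card Y" if "ne \<psi> Y" for \<psi> Y
  proof -
    have "card (parts (M \<psi> Y) i) = 2" if i: "i \<in> Y" for i
    proof -
      \<comment> \<open>Equal fibres would be empty by disjointness, against \<open>ne\<close>; so
        the two blocks are distinct and count as two.\<close>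
      have "psi_fibre U \<psi> {L0} i \<noteq> psi_fibre U \<psi> {L1} i"
        using i \<open>ne \<psi> Y\<close> psi_fibre_disjoint[of U \<psi> i] by (auto simp: ne_def)
      then show ?thesis using i by (simp add: M_def)
    qed
    then show ?thesis by (subst minor_dim_binary) (auto simp: M_def)
  qed
  have sh: "(\<Pi>\<^sub>E i\<in>Y. {L0, L1}) \<subseteq> restr_set Y (psi_bar m U \<psi> ` S) \<longleftrightarrow>
      ne \<psi> Y \<and> shattered S (M \<psi> Y)" if "Y \<subseteq> {1..m}" for \<psi> Y
    unfolding psi_shattered_by_iff[OF S that] M_def shattered_fibres_iff ne_def
    using fibres_nonempty[of Y S U \<psi>] by blast
  \<comment> \<open>By \<open>psi_class\<close> each member of \<open>\<Psi>\<close> has the form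
    \<open>psi_bar m U \<psi>\<close>, so quantifying over members becomes quantifying over
    \<open>\<psi>\<close>.\<close>
  have "psi_shattered \<Psi> S Y \<longleftrightarrow> (\<exists>\<psi>. psi_bar m U \<psi> \<in> \<Psi> \<and> ne \<psi> Y \<and> shattered S (M \<psi> Y))"
    if "Y \<subseteq> {1..m}" for Y
    unfolding psi_shattered_def sh[OF that, symmetric] using \<Psi> by (fastforce simp: psi_class_def)
  then have "{card Y | Y. Y \<subseteq> {1..m} \<and> psi_shattered \<Psi> S Y} = {card Y | Y \<psi>. Y \<subseteq> {1..m} \<and>
      psi_bar m U \<psi> \<in> \<Psi> \<and> ne \<psi> Y \<and> shattered S (M \<psi> Y)}"
    by blast
  also have "\<dots> = {minor_dim (M \<psi> Y) | Y \<psi>. Y \<subseteq> {1..m} \<and>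
      psi_bar m U \<psi> \<in> \<Psi> \<and> ne \<psi> Y \<and> shattered S (M \<psi> Y)}"
    by (intro Collect_cong ex_cong1) (auto simp: dim)
  also have "\<dots> = {minor_dim N | N. N \<in> M_Psi m U \<Psi> \<and> shattered S N}"
    unfolding M_Psi_def M_def[symmetric] ne_def[symmetric] by blast
  finally show ?thesis by (simp add: psi_dim_def minor_density_def)
qed


subsection \<open>DS-dimension\<close>

text \<open>Removing the empty block keeps a partition even when \<open>U i\<close> is a single
  point.\<close>

lemma M_bin_subset_MProd:
  assumes "\<And>i. i \<in> {1..m} \<Longrightarrow> U i \<noteq> {}"
  shows "M_bin m U \<subseteq> MProd m U"
proof -
  have "partition_on (U i) ({{x}, U i - {x}} - {{}})" if "x \<in> U i" for x i
    using that by (auto simp: partition_on_def disjoint_def)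
  then show ?thesis
    using assms by (auto simp: M_bin_def MProd_def subproduct_def PiE_iff)
qed

lemma pseudo_cube_change:
  assumes C: "pseudo_cube U Y C" and a: "a \<in> C" and "finite D" "D \<subseteq> Y"
  shows "\<exists>v\<in>C. {j\<in>Y. a j \<noteq> v j} = D"
  using assms(3,4)
proof (induction D)
  case empty
  then show ?case using a by auto
next
  case (insert i D)
  then obtain v where v: "v \<in> C" "{j\<in>Y. a j \<noteq> v j} = D" by auto
  then obtain w where w: "w \<in> C" "{j\<in>Y. v j \<noteq> w j} = {i}"
    using C insert.prems unfolding pseudo_cube_def by blast
  \<comment> \<open>Since \<open>i\<close> is not in \<open>D\<close>, \<open>v\<close> still agrees
    with \<open>a\<close> at \<open>i\<close>; hence moving away from \<open>v i\<close> also moves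
    away from \<open>a i\<close>, and the changes made on \<open>D\<close> survive.\<close>
  have "a i = v i" using v insert by auto
  moreover have "v j = w j \<longleftrightarrow> j \<noteq> i" if "j \<in> Y" for j using w that by auto
  ultimately have "{j\<in>Y. a j \<noteq> w j} = insert i D"
    using v insert.prems by force
  then show ?case using w by blast
qed

lemma ds_shattered_imp_M_bin:
  assumes Y: "Y \<subseteq> {1..m}" and "ds_shattered U S Y"
  shows "\<exists>M\<in>M_bin m U. shattered S M \<and> minor_dim M = card Y"
proof -
  obtain C where C: "pseudo_cube U Y C" "C \<subseteq> restr_set Y S"
    using assms by (auto simp: ds_shattered_def)
  then obtain a where a: "a \<in> C" by (auto simp: pseudo_cube_def)
  have CU: "C \<subseteq> (\<Pi>\<^sub>E i\<in>Y. U i)" using C by (simp add: pseudo_cube_def)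
  have fin: "finite Y" using Y finite_subset by blast
  define M where "M = \<lparr>supp = Y, factors = (\<lambda>i\<in>Y. U i),
    parts = (\<lambda>i\<in>Y. {{a i}, U i - {a i}} - {{}})\<rparr>"
  have "M \<in> M_bin m U" unfolding M_bin_def M_def using Y a CU by blast
  moreover have "shattered S M"
    unfolding shattered_def
  proof
    fix P assume P: "P \<in> minor_points M"
    \<comment> \<open>\<open>D\<close> collects the coordinates where \<open>P\<close> selects the
      complement of \<open>{a i}\<close>. A point of \<open>C\<close> that leaves \<open>a\<close>
      exactly on \<open>D\<close> therefore lies in every selected block.\<close>
    define D where "D = {i\<in>Y. P i \<noteq> {a i}}"
    have "finite D" "D \<subseteq> Y" using fin by (auto simp: D_def)
    from pseudo_cube_change[OF C(1) a this]
    obtain v where v: "v \<in> C" "{j\<in>Y. a j \<noteq> v j} = D" by blast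
    then obtain s where s: "s \<in> S" "v = restrict s Y"
      using C by (auto simp: restr_set_def)
    have "s i \<in> P i" if i: "i \<in> Y" for i
    proof -
      have U: "v i \<in> U i" using v(1) CU i by blast
      have vs: "v i = s i" using s i by simp
      have P: "P i = {a i} \<or> P i = U i - {a i}"
        using P i by (auto simp: minor_points_def M_def PiE_iff)
      have "a i \<noteq> v i \<longleftrightarrow> P i \<noteq> {a i}" using v(2) i by (auto simp: D_def)
      with U P show ?thesis unfolding vs by (cases "P i = {a i}") auto
    qed
    then show "\<exists>s\<in>S. \<forall>i\<in>supp M. s i \<in> P i" using s by (auto simp: M_def)
  qed
  moreover have "minor_dim M = card Y"
  proof -
    have "card (parts M i) = 2" if i: "i \<in> Y" for i
    proof -
      \<comment> \<open>The neighbour of \<open>a\<close> in direction \<open>i\<close> supplies a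
        second point of \<open>U i\<close>, so the complement block is nonempty and is not
        discarded.\<close>
      obtain v where v: "v \<in> C" "{j\<in>Y. a j \<noteq> v j} = {i}"
        using C(1) a i unfolding pseudo_cube_def by blast
      then have "i \<in> {j\<in>Y. a j \<noteq> v j}" by simp
      then have "v i \<noteq> a i" by force
      moreover have "v i \<in> U i" using CU v(1) i by blast
      ultimately have "parts M i = {{a i}, U i - {a i}}" "{a i} \<noteq> U i - {a i}"
        using i by (auto simp: M_def)
      then show ?thesis by simp
    qed
    then show ?thesis by (subst minor_dim_binary) (auto simp: M_def)
  qed
  ultimately show ?thesis by blast
qed

text \<open>Each DS-shattered \<open>Y\<close> yields a shattered \<open>M(a)\<close> of dimension
  \<open>card Y\<close>; this gives an inclusion of the sets of dimensions, from which the
  inequality follows by finiteness of the larger set.\<close>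

lemma ds_dim_le_density:
  assumes "\<And>i. i \<in> {1..m} \<Longrightarrow> finite (U i) \<and> U i \<noteq> {}"
  shows "ds_dim m U S \<le> minor_density (M_bin m U) S"
  unfolding ds_dim_def minor_density_def
proof (rule Sup_nat_mono)
  show "{card Y | Y. Y \<subseteq> {1..m} \<and> ds_shattered U S Y} \<subseteq>
      {minor_dim M | M. M \<in> M_bin m U \<and> shattered S M}"
  proof safe
    fix Y assume "Y \<subseteq> {1..m}" "ds_shattered U S Y"
    from ds_shattered_imp_M_bin[OF this]
    show "\<exists>M. card Y = minor_dim M \<and> M \<in> M_bin m U \<and> shattered S M" by metis
  qed
  show "finite {minor_dim M | M. M \<in> M_bin m U \<and> shattered S M}"
    using assms by (intro finite_minor_dims[of m U] M_bin_subset_MProd) auto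
qed

section \<open>Comparison of the three dimensions with the VC-density\<close>

theorem proposition6:
  fixes m :: nat and U :: "nat \<Rightarrow> 'a set" and S :: "(nat \<Rightarrow> 'a) set"
  assumes "\<And>i. i \<in> {1..m} \<Longrightarrow> finite (U i) \<and> U i \<noteq> {}"
    and "S \<subseteq> (\<Pi>\<^sub>E i\<in>{1..m}. U i)"
  shows "natarajan_dim m U S = minor_density (M_N m U) S \<and>
    ((\<forall>i\<in>{1..m}. \<forall>j\<in>{1..m}. U i = U j) \<longrightarrow>
       (\<forall>\<Psi>. psi_class m U \<Psi> \<longrightarrow> psi_dim m \<Psi> S = minor_density (M_Psi m U \<Psi>) S)) \<and>
    ds_dim m U S \<le> minor_density (M_bin m U) S \<and>
    natarajan_dim m U S \<le> vc_density m U S \<and>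
    ((\<forall>i\<in>{1..m}. \<forall>j\<in>{1..m}. U i = U j) \<longrightarrow>
       (\<forall>\<Psi>. psi_class m U \<Psi> \<longrightarrow> psi_dim m \<Psi> S \<le> vc_density m U S)) \<and>
    ds_dim m U S \<le> vc_density m U S"
proof -
  have vc: "minor_density \<M> S \<le> vc_density m U S" if "\<M> \<subseteq> MProd m U" for \<M>
    using assms(1) that by (intro minor_density_le_vc_density) auto
  have bin: "M_bin m U \<subseteq> MProd m U"
    using assms(1) by (intro M_bin_subset_MProd) auto
  have ds: "ds_dim m U S \<le> minor_density (M_bin m U) S"
    using assms(1) by (rule ds_dim_le_density)
  show ?thesis
    using natarajan_dim_eq_density[of m U S] vc[OF M_N_subset_MProd]
      psi_dim_eq_density[OF assms(2)] vc[OF M_Psi_subset_MProd]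
      ds order.trans[OF ds vc[OF bin]]
    by simp
qed

end
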